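(* Let $(X,\mathcal{A},P)$ be a probability space, and let $\mathcal{C}$ be a countable class of measurable subsets of $X$ which is a Vapnik–Červonenkis class of index $d$. Then for any $N \geq 1$ there exist points $t_1, \dots, t_N \in X$ for which $$ D_N^{(\mathcal{C},P)} (t_1, \dots, t_N) \leq 2^{13} \frac{\sqrt{d}}{\sqrt{N}}. $$ Consequently, for any $\varepsilon \in (0,1)$ there exists a set of at most $2^{26} d \varepsilon^{-2}$ points of $X$ whose $D^{(\mathcal{C},P)}$-discrepancy does not exceed $\varepsilon$.
   Context: A class $\mathcal{C}$ of subsets of $X$ shatters a finite set $A\subset X$ if for every $B\subseteq A$ there is $C\in\mathcal{C}$ with $B=A\cap C$. $\mathcal{C}$ is a Vapnik–Červonenkis (VC) class of index $d$ if $d$ is the largest finite number such that $\mathcal{C}$ shatters at least one set of cardinality $d$. For $t_1,\dots,t_N\in X$, $$D_N^{(\mathcal{C},P)} (t_1, \dots, t_N) = \sup_{C \in \mathcal{C}} \left| \frac{1}{N} \sum_{n=1}^N \mathbf{1}_C(t_n) - P(C) \right|.$$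
   Formalization: The index d is assumed to be at least 1: for d = 0 the class is a single set C, and P(C) = 1/2, N = 1 violates the bound; the "set" of points in the second claim is a finite sequence in which points may repeat. *)

theory Defs
  imports "HOL-Probability.Probability"
begin

definition shatters :: "'a set set \<Rightarrow> 'a set \<Rightarrow> bool" where
  "shatters \<C> A \<longleftrightarrow> (\<forall>B. B \<subseteq> A \<longrightarrow> (\<exists>C\<in>\<C>. B = A \<inter> C))"

definition VC_class_of_index :: "'a set \<Rightarrow> 'a set set \<Rightarrow> nat \<Rightarrow> bool" where
  "VC_class_of_index X \<C> d \<longleftrightarrow>
     (\<exists>A. A \<subseteq> X \<and> finite A \<and> card A = d \<and> shatters \<C> A) \<and>
     (\<forall>A. A \<subseteq> X \<and> finite A \<and> shatters \<C> A \<longrightarrow> card A \<le> d)"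

text \<open>
  The points \<open>t 1, \<dots>, t N\<close> are a finite sequence, possibly with repetitions.
  The supremum is a real one; for a nonempty class and a probability measure
  all the values lie in \<open>[0, 1]\<close>.
\<close>

definition discrepancy :: "'a measure \<Rightarrow> 'a set set \<Rightarrow> nat \<Rightarrow> (nat \<Rightarrow> 'a) \<Rightarrow> real" where
  "discrepancy P \<C> N t =
     (SUP C\<in>\<C>. \<bar>1 / real N * (\<Sum>n=1..N. indicator C (t n)) - measure P C\<bar>)"

end

theory Submission
  imports Defs
begin

text \<open>
  Draw \<open>t\<^sub>1, \<dots>, t\<^sub>N\<close> independently from \<open>P\<close>. Symmetrization bounds the expected maximal deviation
  over a finite subclass by an average over signs of \<open>max \<bar>\<Sum> \<epsilon>\<^sub>n 1\<^sub>C(t\<^sub>n)\<bar>\<close>, for fixed points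
  \<open>t\<^sub>n\<close>. The traces of the class on the points form a set family of VC dimension at most \<open>d\<close>, whose
  subfamilies with pairwise Hamming distance above \<open>\<delta> N\<close> have at most \<open>\<surd>e (4 / \<delta>) ^ (2 d)\<close>
  members. Chaining along nets at the scales \<open>\<delta> = 4 ^ (-j)\<close> then bounds the average over signs by a
  multiple of \<open>\<surd>(d N)\<close>, without a logarithmic factor. The bound does not depend on the finite
  subclass, so monotone convergence extends it to the countable class. The constant obtained is
  far below \<open>2 ^ 13\<close>, which leaves room for rounding \<open>2 ^ 26 d / \<epsilon>\<^sup>2\<close> down to an integer.
\<close>

subsection \<open>Packing in set families of bounded VC dimension\<close>

text \<open>Induction on the ground set (Pajor's form of the Sauer-Shelah lemma). Deleting a point
  \<open>v\<close> merges the pairs of members that differ only in \<open>v\<close>: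
  \<open>\<G>\<close> counts each merged set once, and \<open>\<H>\<close> collects those that arise
  from two members. A subset of \<open>V\<close> shattered by \<open>\<G>\<close> is shattered by
  \<open>\<F>\<close>; one shattered by \<open>\<H>\<close> stays shattered by \<open>\<F>\<close>
  after \<open>v\<close> is added.\<close>

lemma card_le_card_shattered:
  fixes V :: "'a set"
  assumes "finite V" "\<F> \<subseteq> Pow V"
  shows "card \<F> \<le> card {A. A \<subseteq> V \<and> shatters \<F> A}"
  using assms
proof (induction V arbitrary: \<F> rule: finite_induct)
  case empty
  have "shatters \<F> {}" if "\<F> \<noteq> {}"
    using that by (auto simp: shatters_def)
  then have "{A. A \<subseteq> {} \<and> shatters \<F> A} = {{}}" if "\<F> \<noteq> {}"
    using that by auto
  moreover have "\<F> = {} \<or> \<F> = {{}}"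
    using empty by auto
  ultimately show ?case by fastforce
next
  case (insert v V)
  define \<G> where "\<G> = (\<lambda>S. S - {v}) ` \<F>"
  define \<H> where "\<H> = {S. S \<subseteq> V \<and> S \<in> \<F> \<and> insert v S \<in> \<F>}"
  define sh where "sh = (\<lambda>\<F> V :: 'a set. {A. A \<subseteq> V \<and> shatters \<F> A})"
  have fin: "finite \<F>"
    using insert by (meson finite.insertI finite_Pow_iff finite_subset)
  have GV: "\<G> \<subseteq> Pow V" and HV: "\<H> \<subseteq> Pow V"
    using insert.prems by (auto simp: \<G>_def \<H>_def)
  have finsh: "finite (sh \<F>' V')" if "finite V'" for \<F>' V'
    using that by (simp add: sh_def)
  have "{S \<in> \<F>. v \<notin> S} \<union> {S \<in> \<F>. v \<in> S} = \<F>"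
    by auto
  moreover have "card ({S \<in> \<F>. v \<notin> S} \<union> {S \<in> \<F>. v \<in> S})
      = card {S \<in> \<F>. v \<notin> S} + card {S \<in> \<F>. v \<in> S}"
    using fin by (intro card_Un_disjoint) auto
  ultimately have cF: "card \<F> = card {S \<in> \<F>. v \<notin> S} + card {S \<in> \<F>. v \<in> S}"
    by simp
  have inj: "inj_on (\<lambda>S. S - {v}) {S \<in> \<F>. v \<in> S}"
    by (auto simp: inj_on_def)
  have G: "\<G> = {S \<in> \<F>. v \<notin> S} \<union> (\<lambda>S. S - {v}) ` {S \<in> \<F>. v \<in> S}"
  proof -
    have "(\<lambda>S. S - {v}) ` {S \<in> \<F>. v \<notin> S} = {S \<in> \<F>. v \<notin> S}"
      by (subst image_cong[OF refl, of _ _ id]) auto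
    then show ?thesis
      unfolding \<G>_def by blast
  qed
  have H: "\<H> = {S \<in> \<F>. v \<notin> S} \<inter> (\<lambda>S. S - {v}) ` {S \<in> \<F>. v \<in> S}" (is "_ = ?R")
  proof
    show "\<H> \<subseteq> ?R"
    proof
      fix S assume S: "S \<in> \<H>"
      then have "v \<notin> S" using insert.hyps by (auto simp: \<H>_def)
      then have "S = insert v S - {v}" by auto
      with S \<open>v \<notin> S\<close> show "S \<in> ?R" by (auto simp: \<H>_def)
    qed
    show "?R \<subseteq> \<H>"
      using insert.prems by (auto simp: \<H>_def insert_absorb)
  qed
  \<comment> \<open>The members avoiding \<open>v\<close>, and the members containing
    \<open>v\<close> with \<open>v\<close> removed, form two families with union \<open>\<G>\<close>
    and intersection \<open>\<H>\<close>, so this is inclusion-exclusion.\<close>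
  have "card \<F> = card \<G> + card \<H>"
    unfolding cF card_image[OF inj, symmetric] G H
    using fin by (intro card_Un_Int) auto
  also have "\<dots> \<le> card (sh \<G> V) + card (sh \<H> V)"
    using insert.IH[OF GV] insert.IH[OF HV] by (simp add: sh_def)
  also have "\<dots> = card (sh \<G> V) + card (insert v ` sh \<H> V)"
    using insert.hyps by (subst card_image) (auto simp: inj_on_def sh_def)
  also have "\<dots> = card (sh \<G> V \<union> insert v ` sh \<H> V)"
    using insert.hyps by (subst card_Un_disjoint) (auto simp: finsh, auto simp: sh_def)
  also have "\<dots> \<le> card (sh \<F> (insert v V))"
  proof (intro card_mono)
    show "sh \<G> V \<union> insert v ` sh \<H> V \<subseteq> sh \<F> (insert v V)"
    proof (intro Un_least subsetI)
      fix A assume A: "A \<in> sh \<G> V"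
      then have "v \<notin> A" using insert.hyps by (auto simp: sh_def)
      then have "A \<inter> (S - {v}) = A \<inter> S" for S by auto
      with A show "A \<in> sh \<F> (insert v V)"
        by (auto simp: sh_def \<G>_def shatters_def)
    next
      fix A assume "A \<in> insert v ` sh \<H> V"
      then obtain A' where A': "A = insert v A'" "A' \<subseteq> V" "shatters \<H> A'"
        by (auto simp: sh_def)
      have vA: "v \<notin> A'" using A' insert.hyps by auto
      have "\<exists>C\<in>\<F>. B = A \<inter> C" if B: "B \<subseteq> A" for B
      proof -
        have "B - {v} \<subseteq> A'" using B A' by auto
        then obtain C where C: "C \<in> \<H>" "B - {v} = A' \<inter> C"
          using A'(3) unfolding shatters_def by meson
        \<comment> \<open>Both \<open>C\<close> and \<open>insert v C\<close> are members of
          \<open>\<F>\<close>, so the member can be chosen with or without \<open>v\<close>, as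
          \<open>B\<close> demands.\<close>
        have vC: "v \<notin> C" "C \<in> \<F>" "insert v C \<in> \<F>" using C insert.hyps by (auto simp: \<H>_def)
        show ?thesis
        proof (cases "v \<in> B")
          case True
          then have "B = A \<inter> insert v C" using C A' by auto
          then show ?thesis using vC by blast
        next
          case False
          then have "B = A \<inter> C" using C A' vC by auto
          then show ?thesis using vC by blast
        qed
      qed
      then show "A \<in> sh \<F> (insert v V)"
        using A' by (auto simp: sh_def shatters_def)
    qed
  qed (use insert in \<open>simp add: finsh\<close>)
  finally show ?case by (simp add: sh_def)
qed

text \<open>The weight \<open>x ^ card A\<close> is at least \<open>x ^ d\<close> on the shattered sets, and its sum over
  all subsets of \<open>V\<close> is \<open>(1 + x) ^ card V\<close>.\<close>

lemma card_VC_family_le: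
  fixes x :: real
  assumes V: "finite V" "\<F> \<subseteq> Pow V"
    and VC: "\<And>A. A \<subseteq> V \<Longrightarrow> shatters \<F> A \<Longrightarrow> card A \<le> d"
    and x: "0 < x" "x \<le> 1"
  shows "real (card \<F>) * x ^ d \<le> exp (x * card V)"
proof -
  let ?S = "{A. A \<subseteq> V \<and> shatters \<F> A}"
  have fin: "finite ?S" using V by simp
  have "real (card \<F>) * x ^ d \<le> real (card ?S) * x ^ d"
    using card_le_card_shattered[OF V] x by (intro mult_right_mono) auto
  also have "\<dots> = (\<Sum>A\<in>?S. x ^ d)" by simp
  also have "\<dots> \<le> (\<Sum>A\<in>?S. x ^ card A)"
    using VC x by (intro sum_mono power_decreasing) auto
  also have "\<dots> \<le> (\<Sum>A\<in>Pow V. x ^ card A)"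
    using V x by (intro sum_mono2) auto
  also have "\<dots> = (\<Prod>v\<in>V. x + 1)"
    using V by (subst prod_add) auto
  also have "\<dots> = (1 + x) ^ card V" by (simp add: add.commute)
  also have "\<dots> \<le> exp x ^ card V"
    using x by (intro power_mono) auto
  also have "\<dots> = exp (x * card V)"
    by (simp add: exp_of_nat_mult[symmetric] mult.commute)
  finally show ?thesis .
qed

text \<open>Sample \<open>k\<close> coordinates so that all members of the family differ on the sample;
  the trace on the sample is then counted by the previous lemma.\<close>

lemma ln_card_separated_VC_family_le:
  fixes \<delta> :: real
  assumes V: "finite V" "\<F> \<subseteq> Pow V" and "V \<noteq> {}" "\<F> \<noteq> {}"
    and VC: "\<And>A. A \<subseteq> V \<Longrightarrow> shatters \<F> A \<Longrightarrow> card A \<le> d"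
    and \<delta>: "0 < \<delta>" "\<delta> \<le> 1"
    and sep: "\<And>S T. S \<in> \<F> \<Longrightarrow> T \<in> \<F> \<Longrightarrow> S \<noteq> T \<Longrightarrow> \<delta> * card V < card (sym_diff S T)"
  shows "ln (card \<F>) \<le> 1 / 2 + 2 * d * ln (4 / \<delta>)"
proof -
  define M where "M = real (card \<F>)"
  have fin: "finite \<F>" using V by (meson finite_Pow_iff finite_subset)
  have M: "M \<ge> 1" using \<open>\<F> \<noteq> {}\<close> fin by (simp add: M_def Suc_le_eq card_gt_0_iff)
  \<comment> \<open>Large enough for \<open>M\<^sup>2 * exp (- \<delta> * k) < 1\<close>, which the
    union bound over pairs requires, and no larger, because \<open>k\<close> enters the final count
    through the size of the sample.\<close>
  define k where "k = nat \<lfloor>2 * ln M / \<delta>\<rfloor> + 1"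
  have k: "2 * ln M / \<delta> < k" "k \<le> 2 * ln M / \<delta> + 1"
    using M \<delta> by (simp_all add: k_def) linarith+
  define \<Omega> where "\<Omega> = ({..<k} \<rightarrow>\<^sub>E V)"
  \<comment> \<open>Samples that never hit the symmetric difference, so that \<open>S\<close> and
    \<open>T\<close> leave the same trace on them.\<close>
  define bad where "bad = (\<lambda>(S, T). {..<k} \<rightarrow>\<^sub>E (V - sym_diff S T))"
  define pairs where "pairs = {(S, T). S \<in> \<F> \<and> T \<in> \<F> \<and> S \<noteq> T}"
  have pairs_sub: "pairs \<subseteq> \<F> \<times> \<F>" by (auto simp: pairs_def)
  have fpairs: "finite pairs" using fin by (intro finite_subset[OF pairs_sub]) auto
  \<comment> \<open>Probabilistic method by counting: each pair is missed by at most a fraction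
    \<open>exp (- \<delta> * k)\<close> of the \<open>card V ^ k\<close> samples, and there are at
    most \<open>M\<^sup>2\<close> ordered pairs.\<close>
  have "\<exists>s\<in>\<Omega>. \<forall>p\<in>pairs. s \<notin> bad p"
  proof -
    have cV: "card V > 0" using V \<open>V \<noteq> {}\<close> by auto
    have bad: "real (card (bad p)) \<le> card V ^ k * exp (- \<delta> * k)" if "p \<in> pairs" for p
    proof -
      obtain S T where p: "p = (S, T)" "S \<in> \<F>" "T \<in> \<F>" "S \<noteq> T"
        using \<open>p \<in> pairs\<close> by (cases p) (auto simp: pairs_def)
      have sub: "sym_diff S T \<subseteq> V" using p V by auto
      have "real (card (V - sym_diff S T)) = card V - real (card (sym_diff S T))"
        using sub V by (subst card_Diff_subset) (auto simp: finite_subset card_mono of_nat_diff)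
      also have "\<dots> \<le> card V * (1 - \<delta>)"
        using sep[OF p(2-4)] by (simp add: algebra_simps)
      also have "\<dots> \<le> card V * exp (- \<delta>)"
        using exp_ge_add_one_self[of "- \<delta>"] by (intro mult_left_mono) auto
      finally have "real (card (V - sym_diff S T)) ^ k \<le> (card V * exp (- \<delta>)) ^ k"
        by (intro power_mono) auto
      then show ?thesis
        by (simp add: bad_def p card_PiE power_mult_distrib exp_of_nat_mult[symmetric] mult.commute)
    qed
    have "real (card (\<Union>p\<in>pairs. bad p)) \<le> (\<Sum>p\<in>pairs. real (card (bad p)))"
      using card_UN_le[OF fpairs, of bad] by (metis of_nat_le_iff of_nat_sum)
    also have "\<dots> \<le> (\<Sum>p\<in>pairs. card V ^ k * exp (- \<delta> * k))"
      by (intro sum_mono bad)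
    also have "\<dots> = card pairs * (card V ^ k * exp (- \<delta> * k))" by simp
    also have "\<dots> \<le> M\<^sup>2 * (card V ^ k * exp (- \<delta> * k))"
    proof (intro mult_right_mono)
      have "card pairs \<le> card (\<F> \<times> \<F>)" using pairs_sub fin by (intro card_mono) auto
      then show "real (card pairs) \<le> M\<^sup>2"
        by (simp add: card_cartesian_product M_def power2_eq_square flip: of_nat_mult)
    qed auto
    also have "M\<^sup>2 = exp (2 * ln M)"
      using M by (simp add: exp_double)
    also have "exp (2 * ln M) * (card V ^ k * exp (- \<delta> * k)) = card V ^ k * exp (2 * ln M - \<delta> * k)"
      by (simp add: exp_diff exp_minus field_simps)
    also have "\<dots> < real (card V ^ k) * 1"
      using k(1) \<delta> cV by (intro mult_strict_left_mono) (auto simp: field_simps)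
    also have "\<dots> = real (card \<Omega>)"
      by (simp add: \<Omega>_def card_PiE)
    finally have "card (\<Union>p\<in>pairs. bad p) < card \<Omega>" by simp
    moreover have "finite (\<Union>p\<in>pairs. bad p)"
      using fpairs V by (auto simp: bad_def intro!: finite_PiE)
    ultimately have "\<not> \<Omega> \<subseteq> (\<Union>p\<in>pairs. bad p)"
      using card_mono leD by blast
    then show ?thesis by blast
  qed
  then obtain s where s: "s \<in> \<Omega>" "\<And>p. p \<in> pairs \<Longrightarrow> s \<notin> bad p" by blast
  define W where "W = s ` {..<k}"
  have W: "W \<subseteq> V" "finite W" "card W \<le> k"
    using s(1) card_image_le[of "{..<k}" s] by (auto simp: W_def \<Omega>_def)
  have hit: "sym_diff S T \<inter> W \<noteq> {}" if "S \<in> \<F>" "T \<in> \<F>" "S \<noteq> T" for S T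
  proof
    assume "sym_diff S T \<inter> W = {}"
    then have "s \<in> bad (S, T)"
      using s(1) by (auto simp: bad_def \<Omega>_def W_def PiE_iff)
    with s(2)[of "(S, T)"] that show False by (auto simp: pairs_def)
  qed
  define \<G> where "\<G> = (\<lambda>S. W \<inter> S) ` \<F>"
  have "inj_on (\<lambda>S. W \<inter> S) \<F>"
    using hit by (intro inj_onI) blast
  then have cG: "card \<G> = card \<F>" by (simp add: \<G>_def card_image)
  \<comment> \<open>With weight \<open>\<delta> / 4\<close> the exponent is at most
    \<open>ln M / 2 + 1 / 4\<close>, so that half of \<open>ln M\<close> remains on the left and the
    estimate can be solved for \<open>ln M\<close>.\<close>
  have x: "0 < \<delta> / 4" "\<delta> / 4 \<le> 1" using \<delta> by auto
  have VCG: "card A \<le> d" if A: "A \<subseteq> W" "shatters \<G> A" for A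
  proof (rule VC)
    show "A \<subseteq> V" using A W by auto
    have "A \<inter> (W \<inter> S) = A \<inter> S" for S using A by auto
    with A show "shatters \<F> A" by (auto simp: shatters_def \<G>_def)
  qed
  have "M * (\<delta> / 4) ^ d \<le> exp (\<delta> / 4 * card W)"
    using card_VC_family_le[OF W(2) _ VCG x, of \<G>] cG by (auto simp: \<G>_def M_def)
  also have "\<dots> \<le> exp (ln M / 2 + 1 / 4)"
  proof -
    have "\<delta> / 4 * card W \<le> \<delta> / 4 * (2 * ln M / \<delta> + 1)"
      using W(3) k(2) \<delta> by (intro mult_left_mono) linarith+
    also have "\<dots> = ln M / 2 + \<delta> / 4" using \<delta> by (simp add: field_simps)
    finally show ?thesis using \<delta> by simp
  qed
  finally have "ln (M * (\<delta> / 4) ^ d) \<le> ln (exp (ln M / 2 + 1 / 4))"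
    using M \<delta> by (subst ln_le_cancel_iff) auto
  then have "ln (M * (\<delta> / 4) ^ d) \<le> ln M / 2 + 1 / 4"
    by simp
  moreover have "ln (M * (\<delta> / 4) ^ d) = ln M - d * ln (4 / \<delta>)"
    using M \<delta> by (simp add: ln_mult ln_realpow ln_div algebra_simps)
  ultimately show ?thesis by (simp add: M_def)
qed

subsection \<open>Averages over signs\<close>

text \<open>Comparing the two power series term by term reduces the claim to
  \<open>2 ^ n * fact n \<le> fact (2 * n)\<close>.\<close>

lemma cosh_le_exp_half_square:
  fixes x :: real
  shows "cosh x \<le> exp (x\<^sup>2 / 2)"
proof -
  have "(\<lambda>n. if even n then x ^ n /\<^sub>R fact n else 0) sums cosh x"
    by (rule cosh_converges)
  then have "(\<lambda>n. x ^ (2 * n) /\<^sub>R fact (2 * n)) sums cosh x"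
    by (subst (asm) sums_mono_reindex[of "\<lambda>n. 2 * n", symmetric])
      (auto simp: strict_mono_def elim!: evenE)
  moreover have "(\<lambda>n. (x\<^sup>2 / 2) ^ n /\<^sub>R fact n) sums exp (x\<^sup>2 / 2)"
    by (rule exp_converges)
  moreover have "x ^ (2 * n) /\<^sub>R fact (2 * n) \<le> (x\<^sup>2 / 2) ^ n /\<^sub>R fact n" for n
  proof -
    have "(2 ^ n * fact n :: real) \<le> fact (2 * n)"
    proof (induction n)
      case (Suc n)
      have "(2 ^ Suc n * fact (Suc n) :: real) = (2 * (real n + 1)) * (2 ^ n * fact n)"
        by (simp add: algebra_simps)
      also have "\<dots> \<le> (2 * (real n + 1)) * fact (2 * n)"
        using Suc by (intro mult_left_mono) auto
      also have "\<dots> \<le> (2 * (real n + 1)) * ((2 * real n + 1) * fact (2 * n))"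
        by (intro mult_left_mono) auto
      also have "\<dots> = fact (2 * Suc n)"
        by (simp add: algebra_simps)
      finally show ?case .
    qed simp
    then have "(x\<^sup>2) ^ n / fact (2 * n) \<le> (x\<^sup>2) ^ n / (2 ^ n * fact n)"
      by (intro divide_left_mono) auto
    then show ?thesis
      unfolding power_mult power_divide by (simp add: field_simps)
  qed
  ultimately show ?thesis
    by (rule sums_le[rotated 1])
qed

text \<open>The extensional function space is finite for finite \<open>V\<close>, so expectations
  over independent random signs become finite averages instead of integrals.\<close>

definition signs :: "'i set \<Rightarrow> ('i \<Rightarrow> real) set" where
  "signs V = (V \<rightarrow>\<^sub>E {-1, 1})"

definition sign_mean :: "'i set \<Rightarrow> (('i \<Rightarrow> real) \<Rightarrow> real) \<Rightarrow> real" where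
  "sign_mean V f = (\<Sum>\<epsilon>\<in>signs V. f \<epsilon>) / 2 ^ card V"

lemma finite_signs: "finite V \<Longrightarrow> finite (signs V)"
  by (auto simp: signs_def intro: finite_PiE)

lemma card_signs: "finite V \<Longrightarrow> card (signs V) = 2 ^ card V"
  by (simp add: signs_def card_PiE numeral_2_eq_2)

lemma sign_mean_mono:
  "(\<And>\<epsilon>. \<epsilon> \<in> signs V \<Longrightarrow> f \<epsilon> \<le> g \<epsilon>) \<Longrightarrow> sign_mean V f \<le> sign_mean V g"
  unfolding sign_mean_def by (intro divide_right_mono sum_mono) auto

lemma sign_mean_add: "sign_mean V (\<lambda>\<epsilon>. f \<epsilon> + g \<epsilon>) = sign_mean V f + sign_mean V g"
  by (simp add: sign_mean_def sum.distrib add_divide_distrib)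

lemma sign_mean_cmult: "sign_mean V (\<lambda>\<epsilon>. c * f \<epsilon>) = c * sign_mean V f"
  by (simp add: sign_mean_def sum_distrib_left)

lemma sign_mean_sum: "sign_mean V (\<lambda>\<epsilon>. \<Sum>i\<in>I. f i \<epsilon>) = (\<Sum>i\<in>I. sign_mean V (f i))"
  unfolding sign_mean_def by (subst sum.swap) (simp add: sum_divide_distrib)

lemma sign_mean_const: "finite V \<Longrightarrow> sign_mean V (\<lambda>_. c) = c"
  by (simp add: sign_mean_def card_signs)

text \<open>Independence of the signs factors the mean into a product of \<open>cosh (c n)\<close>,
  and each factor is at most \<open>exp ((c n)\<^sup>2 / 2)\<close>. Signed sums are thus
  sub-Gaussian.\<close>

lemma sign_mean_exp_le:
  assumes "finite V"
  shows "sign_mean V (\<lambda>\<epsilon>. exp (\<Sum>n\<in>V. c n * \<epsilon> n)) \<le> exp ((\<Sum>n\<in>V. (c n)\<^sup>2) / 2)"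
proof -
  have "(\<Sum>\<epsilon>\<in>signs V. exp (\<Sum>n\<in>V. c n * \<epsilon> n)) = (\<Prod>n\<in>V. \<Sum>y\<in>{-1, 1}. exp (c n * y))"
    using assms by (subst prod_sum_PiE) (auto simp: signs_def exp_sum)
  also have "\<dots> = (\<Prod>n\<in>V. 2 * cosh (c n))"
    by (intro prod.cong) (auto simp: cosh_def)
  also have "\<dots> = 2 ^ card V * (\<Prod>n\<in>V. cosh (c n))"
    by (simp add: prod.distrib)
  finally have "sign_mean V (\<lambda>\<epsilon>. exp (\<Sum>n\<in>V. c n * \<epsilon> n)) = (\<Prod>n\<in>V. cosh (c n))"
    by (simp add: sign_mean_def)
  also have "\<dots> \<le> (\<Prod>n\<in>V. exp ((c n)\<^sup>2 / 2))"
    by (intro prod_mono) (auto simp: cosh_le_exp_half_square)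
  also have "\<dots> = exp ((\<Sum>n\<in>V. (c n)\<^sup>2) / 2)"
    using assms by (simp add: exp_sum sum_divide_distrib)
  finally show ?thesis .
qed

text \<open>The exponential of the maximum is dominated by a sum of \<open>2 * card I\<close>
  exponentials, two for each absolute value, and each has a sub-Gaussian mean. The parameter
  \<open>\<theta>\<close> stays free so that chaining can tune it at every scale.\<close>

lemma sign_mean_Max_le:
  assumes "finite V" and I: "finite I" "I \<noteq> {}" and "\<theta> > 0"
    and c: "\<And>i. i \<in> I \<Longrightarrow> (\<Sum>n\<in>V. (c i n)\<^sup>2) \<le> s"
  shows "sign_mean V (\<lambda>\<epsilon>. Max ((\<lambda>i. \<bar>\<Sum>n\<in>V. c i n * \<epsilon> n\<bar>) ` I))
    \<le> ln (2 * real (card I)) / \<theta> + \<theta> * s / 2"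
proof -
  define X where "X = (\<lambda>i \<epsilon>. \<Sum>n\<in>V. c i n * \<epsilon> n)"
  \<comment> \<open>\<open>exp L\<close> bounds the mean of the sum of all \<open>2 * card I\<close>
    exponentials.\<close>
  define L where "L = ln (2 * real (card I)) + \<theta>\<^sup>2 * s / 2"
  have cI: "card I > 0" using I by (simp add: card_gt_0_iff)
  \<comment> \<open>The tangent inequality \<open>u \<le> L - 1 + exp (u - L)\<close>, used
    pointwise, takes the place of Jensen's inequality for the logarithm; averaging the right-hand
    side gives at most \<open>L\<close>.\<close>
  have pt: "\<theta> * Max ((\<lambda>i. \<bar>X i \<epsilon>\<bar>) ` I)
      \<le> (L - 1) + exp (- L) * (\<Sum>i\<in>I. exp (\<theta> * X i \<epsilon>) + exp (- (\<theta> * X i \<epsilon>)))" for \<epsilon>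
  proof -
    have "Max ((\<lambda>i. \<bar>X i \<epsilon>\<bar>) ` I) \<in> (\<lambda>i. \<bar>X i \<epsilon>\<bar>) ` I"
      using I by (intro Max_in) auto
    then obtain i where i: "i \<in> I" "Max ((\<lambda>i. \<bar>X i \<epsilon>\<bar>) ` I) = \<bar>X i \<epsilon>\<bar>" by auto
    have "\<theta> * \<bar>X i \<epsilon>\<bar> \<le> (L - 1) + exp (\<theta> * \<bar>X i \<epsilon>\<bar> - L)"
      using exp_ge_add_one_self[of "\<theta> * \<bar>X i \<epsilon>\<bar> - L"] by linarith
    also have "exp (\<theta> * \<bar>X i \<epsilon>\<bar> - L) = exp (- L) * exp (\<theta> * \<bar>X i \<epsilon>\<bar>)"
      by (simp add: exp_diff exp_minus field_simps)
    also have "(L - 1) + exp (- L) * exp (\<theta> * \<bar>X i \<epsilon>\<bar>)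
        \<le> (L - 1) + exp (- L) * (\<Sum>i\<in>I. exp (\<theta> * X i \<epsilon>) + exp (- (\<theta> * X i \<epsilon>)))"
    proof (intro add_left_mono mult_left_mono)
      have "exp (\<theta> * \<bar>X i \<epsilon>\<bar>) \<le> exp (\<theta> * X i \<epsilon>) + exp (- (\<theta> * X i \<epsilon>))"
        by (cases "X i \<epsilon> \<ge> 0") auto
      also have "\<dots> \<le> (\<Sum>i\<in>I. exp (\<theta> * X i \<epsilon>) + exp (- (\<theta> * X i \<epsilon>)))"
        using I i by (intro member_le_sum) (auto intro: add_nonneg_nonneg)
      finally show "exp (\<theta> * \<bar>X i \<epsilon>\<bar>) \<le> \<dots>" .
    qed simp
    finally show ?thesis by (simp add: i)
  qed
  have E: "sign_mean V (\<lambda>\<epsilon>. exp (a * X i \<epsilon>)) \<le> exp (\<theta>\<^sup>2 * s / 2)"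
    if "i \<in> I" "a = \<theta> \<or> a = - \<theta>" for i a
  proof -
    have "sign_mean V (\<lambda>\<epsilon>. exp (a * X i \<epsilon>)) \<le> exp ((\<Sum>n\<in>V. (a * c i n)\<^sup>2) / 2)"
      using sign_mean_exp_le[OF assms(1), of "\<lambda>n. a * c i n"]
      by (simp add: X_def sum_distrib_left mult.assoc)
    also have "(\<Sum>n\<in>V. (a * c i n)\<^sup>2) = \<theta>\<^sup>2 * (\<Sum>n\<in>V. (c i n)\<^sup>2)"
      using that by (auto simp: power_mult_distrib sum_distrib_left)
    also have "exp (\<dots> / 2) \<le> exp (\<theta>\<^sup>2 * s / 2)"
      using c[OF that(1)] by (auto intro!: mult_left_mono)
    finally show ?thesis .
  qed
  have "\<theta> * sign_mean V (\<lambda>\<epsilon>. Max ((\<lambda>i. \<bar>X i \<epsilon>\<bar>) ` I))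
      \<le> sign_mean V (\<lambda>\<epsilon>. (L - 1) + exp (- L) * (\<Sum>i\<in>I. exp (\<theta> * X i \<epsilon>) + exp (- (\<theta> * X i \<epsilon>))))"
    unfolding sign_mean_cmult[symmetric] by (intro sign_mean_mono pt)
  also have "\<dots> = (L - 1) + exp (- L) * (\<Sum>i\<in>I. sign_mean V (\<lambda>\<epsilon>. exp (\<theta> * X i \<epsilon>))
      + sign_mean V (\<lambda>\<epsilon>. exp ((- \<theta>) * X i \<epsilon>)))"
    using assms by (simp add: sign_mean_add sign_mean_cmult sign_mean_const sign_mean_sum)
  also have "\<dots> \<le> (L - 1) + exp (- L) * (\<Sum>i\<in>I. exp (\<theta>\<^sup>2 * s / 2) + exp (\<theta>\<^sup>2 * s / 2))"
    by (intro add_left_mono mult_left_mono sum_mono add_mono E) auto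
  also have "\<dots> = (L - 1) + exp (- L) * exp L"
    using cI by (simp add: L_def exp_add)
  also have "\<dots> = L" by (simp flip: exp_add)
  finally have "sign_mean V (\<lambda>\<epsilon>. Max ((\<lambda>i. \<bar>X i \<epsilon>\<bar>) ` I)) \<le> L / \<theta>"
    using \<open>\<theta> > 0\<close> by (simp add: field_simps)
  also have "L / \<theta> = ln (2 * real (card I)) / \<theta> + \<theta> * s / 2"
    using \<open>\<theta> > 0\<close> by (simp add: L_def field_simps power2_eq_square)
  finally show ?thesis by (simp add: X_def)
qed

subsection \<open>Chaining\<close>

lemma shatters_mono: "\<F> \<subseteq> \<G> \<Longrightarrow> shatters \<F> A \<Longrightarrow> shatters \<G> A"
  unfolding shatters_def by (meson subsetD)

text \<open>Greedy construction: a point joins the net only if it is farther than \<open>r\<close>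
  from every point chosen before, and a rejected point is already covered.\<close>

lemma separated_net_exists:
  fixes D :: "'b \<Rightarrow> 'b \<Rightarrow> real"
  assumes "finite F" and refl: "\<And>x. D x x \<le> r" and sym: "\<And>x y. D x y = D y x"
  obtains G where "G \<subseteq> F" "\<And>x y. x \<in> G \<Longrightarrow> y \<in> G \<Longrightarrow> x \<noteq> y \<Longrightarrow> r < D x y"
    "\<And>x. x \<in> F \<Longrightarrow> \<exists>y\<in>G. D x y \<le> r"
proof -
  have "\<exists>G\<subseteq>F. (\<forall>x\<in>G. \<forall>y\<in>G. x \<noteq> y \<longrightarrow> r < D x y) \<and> (\<forall>x\<in>F. \<exists>y\<in>G. D x y \<le> r)"
    using assms(1)
  proof induction
    case (insert z F)
    then obtain G where G: "G \<subseteq> F" "\<forall>x\<in>G. \<forall>y\<in>G. x \<noteq> y \<longrightarrow> r < D x y"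
      "\<forall>x\<in>F. \<exists>y\<in>G. D x y \<le> r" by blast
    show ?case
    proof (cases "\<exists>y\<in>G. D z y \<le> r")
      case True
      with G show ?thesis by (intro exI[of _ G]) auto
    next
      case False
      then have far: "\<forall>y\<in>G. r < D z y" by (simp add: not_le)
      have "\<forall>x\<in>insert z G. \<forall>y\<in>insert z G. x \<noteq> y \<longrightarrow> r < D x y"
        using G(2) far sym by (metis insert_iff)
      moreover have "\<forall>x\<in>insert z F. \<exists>y\<in>insert z G. D x y \<le> r"
        using G(3) refl by (metis insert_iff)
      ultimately show ?thesis
        using G(1) by (intro exI[of _ "insert z G"]) blast
    qed
  qed auto
  then obtain G where G: "G \<subseteq> F" "\<forall>x\<in>G. \<forall>y\<in>G. x \<noteq> y \<longrightarrow> r < D x y"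
    "\<forall>x\<in>F. \<exists>y\<in>G. D x y \<le> r" by blast
  show thesis
    by (rule that[of G]) (use G in simp_all)
qed

text \<open>The net at scale \<open>4 ^ (-j)\<close> has log-cardinality at most of order
  \<open>d * (j + 1)\<close>, while a link from the next net down to it has squared norm at most
  \<open>4 ^ (-j) * card V\<close>. Passing between them costs at most a multiple of
  \<open>(j + 1) * 2 ^ (-j) * sqrt d * sqrt (card V)\<close>, and these costs are summable.\<close>

lemma sign_mean_Max_VC_family_le:
  fixes V :: "'a set"
  assumes V: "finite V" "V \<noteq> {}" and F: "\<F> \<subseteq> Pow V" "\<F> \<noteq> {}"
    and VC: "\<And>A. A \<subseteq> V \<Longrightarrow> shatters \<F> A \<Longrightarrow> card A \<le> d" and "d \<ge> 1"
  shows "sign_mean V (\<lambda>\<epsilon>. Max ((\<lambda>S. \<bar>\<Sum>n\<in>V. indicator S n * \<epsilon> n\<bar>) ` \<F>))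
    \<le> 23 * (sqrt d * sqrt (card V))"
proof -
  define a b where "a = sqrt d" and "b = sqrt (card V)"
  have ab: "a > 0" "b > 0" "real d = a\<^sup>2" "real (card V) = b\<^sup>2"
    using V \<open>d \<ge> 1\<close> by (auto simp: a_def b_def card_gt_0_iff)
  have fin: "finite \<F>" using V F by (meson finite_Pow_iff finite_subset)
  define m where "m = (\<lambda>\<G>. sign_mean V (\<lambda>\<epsilon>. Max ((\<lambda>S. \<bar>\<Sum>n\<in>V. indicator S n * \<epsilon> n\<bar>) ` \<G>)))"
  define D where "D = (\<lambda>S T :: 'a set. real (card (sym_diff S T)))"
  \<comment> \<open>Separation bounds the size of a net through
    \<open>ln_card_separated_VC_family_le\<close>; covering supplies the approximations that form
    the chain.\<close>
  define is_net where "is_net = (\<lambda>(j :: nat) G. G \<subseteq> \<F> \<and>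
      (\<forall>S\<in>G. \<forall>T\<in>G. S \<noteq> T \<longrightarrow> (1 / 4) ^ j * real (card V) < D S T) \<and>
      (\<forall>S\<in>\<F>. \<exists>T\<in>G. D S T \<le> (1 / 4) ^ j * real (card V)))"
  have D: "D S S \<le> (1 / 4) ^ j * real (card V)" "D S T = D T S" for S T j
    by (simp_all add: D_def Un_commute)
  have "\<exists>G. is_net j G" for j
    using separated_net_exists[OF fin, of D, OF D]
    unfolding is_net_def by metis
  then obtain G where G: "\<And>j. is_net j (G j)" by metis
  have sub: "G j \<subseteq> \<F>" for j
    using G[of j] by (simp add: is_net_def)
  have sep: "(1 / 4) ^ j * real (card V) < real (card (sym_diff S T))"
    if "S \<in> G j" "T \<in> G j" "S \<noteq> T" for j S T
    using G[of j] that by (simp add: is_net_def D_def)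
  have net: "\<exists>T\<in>G j. real (card (sym_diff S T)) \<le> (1 / 4) ^ j * real (card V)"
    if "S \<in> \<F>" for j S
    using G[of j] that by (simp add: is_net_def D_def)
  have finG: "finite (G j)" for j
    using sub[of j] fin by (rule finite_subset)
  have neG: "G j \<noteq> {}" for j
    using net[of _ j] F(2) by blast
  \<comment> \<open>Coarse constants suffice: \<open>ln 4 \<le> 2\<close>, and
    \<open>ln 2 + 1 / 2 \<le> 2 * d\<close> because \<open>d \<ge> 1\<close>.\<close>
  have lnG: "ln (2 * real (card (G j))) \<le> a\<^sup>2 * (6 + 4 * real j)" for j
  proof -
    have VCG: "card A \<le> d" if "A \<subseteq> V" "shatters (G j) A" for A
      using VC[OF that(1) shatters_mono[OF sub that(2)]] .
    have "ln (card (G j)) \<le> 1 / 2 + 2 * real d * ln (4 / (1 / 4) ^ j)"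
      by (rule ln_card_separated_VC_family_le[OF V(1) subset_trans[OF sub F(1)] V(2) neG VCG _ _ sep])
        (simp_all add: power_le_one)
    also have "4 / (1 / 4) ^ j = (4 :: real) ^ (j + 1)"
      by (simp add: power_divide)
    also have "ln (4 ^ (j + 1)) = real (j + 1) * ln (4 :: real)"
      by (rule ln_realpow)
    also have "1 / 2 + 2 * real d * (real (j + 1) * ln 4) \<le> 1 / 2 + 2 * real d * (real (j + 1) * 2)"
    proof (intro add_left_mono mult_left_mono)
      have "ln (4 :: real) = ln (2 ^ 2)" by simp
      also have "\<dots> = 2 * ln 2" by (subst ln_realpow) simp_all
      finally show "ln (4 :: real) \<le> 2" using ln_2_less_1 by linarith
    qed simp_all
    finally have "ln (card (G j)) \<le> 1 / 2 + 2 * real d * (real (j + 1) * 2)" .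
    moreover have "ln (2 * real (card (G j))) = ln 2 + ln (card (G j))"
      using finG[of j] neG[of j] by (intro ln_mult_pos) (simp_all add: card_gt_0_iff)
    moreover have "real d * (6 + 4 * real j) = 2 * real d + 2 * real d * (real (j + 1) * 2)"
      by (simp add: algebra_simps)
    moreover have "real d \<ge> 1" using \<open>d \<ge> 1\<close> by simp
    ultimately have "ln (2 * real (card (G j))) \<le> real d * (6 + 4 * real j)"
      using ln_2_less_1 by linarith
    then show ?thesis by (simp add: ab)
  qed
  \<comment> \<open>The bracket is chosen to telescope: from \<open>j\<close> to
    \<open>j + 1\<close> it grows by \<open>(12 + 4 * j) * (1 / 2) ^ (j + 1)\<close>, exactly the
    cost of the new link. At \<open>j = 0\<close> it equals \<open>7\<close>.\<close>
  have bound: "m (G j) \<le> a * b * (23 - (16 + 4 * real j) * (1 / 2) ^ j)" for j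
  proof (induction j)
    case 0
    have "(\<Sum>n\<in>V. (indicator S n)\<^sup>2) \<le> b\<^sup>2" for S :: "'a set"
    proof -
      have "(\<Sum>n\<in>V. (indicator S n)\<^sup>2) \<le> (\<Sum>n\<in>V. 1 :: real)"
        by (intro sum_mono) (auto simp: indicator_def)
      then show ?thesis by (simp add: ab)
    qed
    \<comment> \<open>With \<open>\<theta> = a / b\<close> both terms become multiples of
      \<open>a * b\<close>, namely \<open>6\<close> and \<open>1 / 2\<close>.\<close>
    then have "m (G 0) \<le> ln (2 * real (card (G 0))) / (a / b) + (a / b) * b\<^sup>2 / 2"
      unfolding m_def using V finG neG ab by (intro sign_mean_Max_le) auto
    also have "\<dots> \<le> (a\<^sup>2 * 6) / (a / b) + (a / b) * b\<^sup>2 / 2"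
      using lnG[of 0] ab by (intro add_mono divide_right_mono) auto
    also have "\<dots> = a * b * (13 / 2)"
      using ab by (simp add: field_simps power2_eq_square)
    also have "\<dots> \<le> a * b * 7"
      using ab by (intro mult_left_mono) auto
    finally show ?case by simp
  next
    case (Suc j)
    obtain \<pi> where \<pi>: "\<And>S. S \<in> \<F> \<Longrightarrow> \<pi> S \<in> G j"
      "\<And>S. S \<in> \<F> \<Longrightarrow> real (card (sym_diff S (\<pi> S))) \<le> (1 / 4) ^ j * real (card V)"
      using net[of _ j] by metis
    \<comment> \<open>The link from \<open>S\<close> to its approximation. Its values are
      \<open>-1\<close>, \<open>0\<close> and \<open>1\<close>, so the sum of squares is a Hamming
      distance.\<close>
    define c where "c = (\<lambda>S n. indicator S n - indicator (\<pi> S) n :: real)"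
    \<comment> \<open>Doubling \<open>\<theta>\<close> while the squared norms shrink by a factor of
      four makes both the entropy term and the variance term decay like \<open>2 ^ (-j)\<close>, up
      to a factor linear in \<open>j\<close>.\<close>
    define \<theta> where "\<theta> = a / b * 2 ^ Suc j"
    have s: "(\<Sum>n\<in>V. (c S n)\<^sup>2) \<le> (1 / 4) ^ j * b\<^sup>2" if "S \<in> G (Suc j)" for S
    proof -
      have "sym_diff S (\<pi> S) \<subseteq> V"
        using that sub[of "Suc j"] sub[of j] F(1) \<pi>(1)[of S] by blast
      then have "V \<inter> sym_diff S (\<pi> S) = sym_diff S (\<pi> S)" by blast
      moreover have "(c S n)\<^sup>2 = (if n \<in> sym_diff S (\<pi> S) then 1 else 0)" for n
        by (simp add: c_def indicator_def)
      then have "(\<Sum>n\<in>V. (c S n)\<^sup>2) = real (card (V \<inter> sym_diff S (\<pi> S)))"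
        using V(1) by (simp only: sum.If_cases Collect_mem_eq) simp
      ultimately have "(\<Sum>n\<in>V. (c S n)\<^sup>2) = real (card (sym_diff S (\<pi> S)))"
        by simp
      then show ?thesis using \<pi>(2)[of S] that sub[of "Suc j"] by (auto simp: ab)
    qed
    have "m (G (Suc j)) \<le> sign_mean V (\<lambda>\<epsilon>. Max ((\<lambda>S. \<bar>\<Sum>n\<in>V. indicator S n * \<epsilon> n\<bar>) ` G j)
        + Max ((\<lambda>S. \<bar>\<Sum>n\<in>V. c S n * \<epsilon> n\<bar>) ` G (Suc j)))"
      unfolding m_def
    proof (intro sign_mean_mono Max.boundedI)
      fix \<epsilon> :: "'a \<Rightarrow> real" and y assume "y \<in> (\<lambda>S. \<bar>\<Sum>n\<in>V. indicator S n * \<epsilon> n\<bar>) ` G (Suc j)"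
      then obtain S where S: "S \<in> G (Suc j)" "y = \<bar>\<Sum>n\<in>V. indicator S n * \<epsilon> n\<bar>" by blast
      have "(\<Sum>n\<in>V. indicator S n * \<epsilon> n) = (\<Sum>n\<in>V. indicator (\<pi> S) n * \<epsilon> n) + (\<Sum>n\<in>V. c S n * \<epsilon> n)"
        by (simp add: c_def algebra_simps flip: sum.distrib)
      then have "y \<le> \<bar>\<Sum>n\<in>V. indicator (\<pi> S) n * \<epsilon> n\<bar> + \<bar>\<Sum>n\<in>V. c S n * \<epsilon> n\<bar>"
        using S by linarith
      also have "\<dots> \<le> Max ((\<lambda>S. \<bar>\<Sum>n\<in>V. indicator S n * \<epsilon> n\<bar>) ` G j)
          + Max ((\<lambda>S. \<bar>\<Sum>n\<in>V. c S n * \<epsilon> n\<bar>) ` G (Suc j))"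
        using finG S(1) \<pi>(1)[of S] sub[of "Suc j"] by (intro add_mono Max_ge) auto
      finally show "y \<le> \<dots>" .
    qed (use finG neG in auto)
    also have "\<dots> = m (G j) + sign_mean V (\<lambda>\<epsilon>. Max ((\<lambda>S. \<bar>\<Sum>n\<in>V. c S n * \<epsilon> n\<bar>) ` G (Suc j)))"
      by (simp add: sign_mean_add m_def)
    also have "\<dots> \<le> m (G j) + (ln (2 * real (card (G (Suc j)))) / \<theta> + \<theta> * ((1 / 4) ^ j * b\<^sup>2) / 2)"
      using V finG neG ab s by (intro add_left_mono sign_mean_Max_le) (auto simp: \<theta>_def)
    also have "\<dots> \<le> m (G j) + (a\<^sup>2 * (6 + 4 * real (Suc j)) / \<theta> + \<theta> * ((1 / 4) ^ j * b\<^sup>2) / 2)"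
      using lnG[of "Suc j"] ab by (intro add_left_mono add_mono divide_right_mono) (auto simp: \<theta>_def)
    also have "a\<^sup>2 * (6 + 4 * real (Suc j)) / \<theta> = a * b * (6 + 4 * real (Suc j)) * (1 / 2) ^ Suc j"
      using ab by (simp add: \<theta>_def field_simps power2_eq_square power_divide)
    also have "\<theta> * ((1 / 4) ^ j * b\<^sup>2) / 2 = a * b * (2 ^ j * (1 / 4) ^ j)"
      using ab by (simp add: \<theta>_def field_simps power2_eq_square)
    also have "2 ^ j * (1 / 4) ^ j = (1 / 2 :: real) ^ j"
      by (simp flip: power_mult_distrib)
    also have "m (G j) + (a * b * (6 + 4 * real (Suc j)) * (1 / 2) ^ Suc j + a * b * (1 / 2) ^ j)
        \<le> a * b * (23 - (16 + 4 * real j) * (1 / 2) ^ j)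
          + (a * b * (6 + 4 * real (Suc j)) * (1 / 2) ^ Suc j + a * b * (1 / 2) ^ j)"
      using Suc.IH by simp
    also have "\<dots> = a * b * (23 - (16 + 4 * real (Suc j)) * (1 / 2) ^ Suc j)"
      by (simp add: algebra_simps)
    finally show ?case by simp
  qed
  \<comment> \<open>Once the radius is below \<open>1\<close>, integrality of the Hamming distance
    forces the net to be all of \<open>\<F>\<close>, and the chain stops.\<close>
  obtain j where j: "(1 / 4) ^ j * b\<^sup>2 < 1"
  proof -
    obtain j where "(1 / 4 :: real) ^ j < 1 / b\<^sup>2"
      using real_arch_pow_inv[of "1 / b\<^sup>2" "1 / 4"] ab by auto
    with that ab show thesis by (auto simp: field_simps)
  qed
  have "G j = \<F>"
  proof
    show "\<F> \<subseteq> G j"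
    proof
      fix S assume S: "S \<in> \<F>"
      then obtain T where T: "T \<in> G j" "real (card (sym_diff S T)) \<le> (1 / 4) ^ j * real (card V)"
        using net by blast
      then have "card (sym_diff S T) = 0" using j by (simp add: ab)
      moreover have "finite (sym_diff S T)"
        using finite_subset[OF _ V(1)] F(1) S T(1) sub[of j] by blast
      ultimately have "sym_diff S T = {}" by simp
      then have "S = T" by blast
      with T show "S \<in> G j" by simp
    qed
  qed (rule sub)
  then have "m \<F> \<le> a * b * (23 - (16 + 4 * real j) * (1 / 2) ^ j)"
    using bound[of j] by simp
  also have "\<dots> \<le> a * b * 23"
    using ab by (intro mult_left_mono) auto
  finally show ?thesis by (simp add: m_def a_def b_def)
qed

subsection \<open>Symmetrization\<close>

text \<open>Sample points may coincide, so traces are sets of indices. If the traces shatter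
  \<open>A\<close>, cutting out singletons forces \<open>x\<close> to be injective on
  \<open>A\<close>; the image of \<open>A\<close> under \<open>x\<close> then has the same
  cardinality and is shattered by \<open>\<D>\<close>.\<close>

lemma card_le_if_shatters_traces:
  assumes "x \<in> V \<rightarrow> X" "A \<subseteq> V" "finite V"
    and VC: "\<And>A. A \<subseteq> X \<Longrightarrow> finite A \<Longrightarrow> shatters \<D> A \<Longrightarrow> card A \<le> d"
    and sh: "shatters ((\<lambda>C. {n \<in> V. x n \<in> C}) ` \<D>) A"
  shows "card A \<le> d"
proof -
  have ex: "\<exists>C\<in>\<D>. B = {n \<in> A. x n \<in> C}" if "B \<subseteq> A" for B
  proof -
    obtain C where "C \<in> \<D>" "B = A \<inter> {n \<in> V. x n \<in> C}"
      using sh \<open>B \<subseteq> A\<close> unfolding shatters_def by blast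
    then show ?thesis using assms(2) by blast
  qed
  have "inj_on x A"
  proof (rule inj_onI)
    fix m n assume mn: "m \<in> A" "n \<in> A" "x m = x n"
    obtain C where C: "{m} = {k \<in> A. x k \<in> C}" using ex[of "{m}"] mn by blast
    then have "m \<in> {k \<in> A. x k \<in> C}" by blast
    then have "n \<in> {k \<in> A. x k \<in> C}" using mn by simp
    then show "m = n" unfolding C[symmetric] by simp
  qed
  have "shatters \<D> (x ` A)"
    unfolding shatters_def
  proof (intro allI impI)
    fix B assume B: "B \<subseteq> x ` A"
    obtain C where C: "C \<in> \<D>" "{n \<in> A. x n \<in> B} = {n \<in> A. x n \<in> C}"
      using ex[of "{n \<in> A. x n \<in> B}"] by blast
    then have "B = x ` A \<inter> C" using B by blast
    with C show "\<exists>C\<in>\<D>. B = x ` A \<inter> C" by blast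
  qed
  then have "card (x ` A) \<le> d"
    using assms(1-3) by (intro VC) (auto intro: finite_subset)
  with card_image[OF \<open>inj_on x A\<close>] show ?thesis by simp
qed

lemma sign_mean_Max_VC_class_le:
  assumes V: "finite V" "V \<noteq> {}" and D: "finite \<D>" "\<D> \<noteq> {}" and x: "x \<in> V \<rightarrow> X"
    and VC: "\<And>A. A \<subseteq> X \<Longrightarrow> finite A \<Longrightarrow> shatters \<D> A \<Longrightarrow> card A \<le> d" and "d \<ge> 1"
  shows "sign_mean V (\<lambda>\<epsilon>. Max ((\<lambda>C. \<bar>\<Sum>n\<in>V. indicator C (x n) * \<epsilon> n\<bar>) ` \<D>))
    \<le> 23 * (sqrt d * sqrt (card V))"
proof -
  let ?F = "(\<lambda>C. {n \<in> V. x n \<in> C}) ` \<D>"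
  have "sign_mean V (\<lambda>\<epsilon>. Max ((\<lambda>S. \<bar>\<Sum>n\<in>V. indicator S n * \<epsilon> n\<bar>) ` ?F))
      \<le> 23 * (sqrt d * sqrt (card V))"
    using card_le_if_shatters_traces[OF x _ V(1) VC] D
    by (intro sign_mean_Max_VC_family_le[OF V _ _ _ \<open>d \<ge> 1\<close>]) auto
  moreover have "(\<Sum>n\<in>V. indicator {n \<in> V. x n \<in> C} n * \<epsilon> n) = (\<Sum>n\<in>V. indicator C (x n) * \<epsilon> n)"
    for C and \<epsilon> :: "'a \<Rightarrow> real"
    by (intro sum.cong) (auto simp: indicator_def)
  ultimately show ?thesis by (simp add: image_image)
qed

lemma (in prob_space) integral_PiM_component:
  fixes f :: "'a \<Rightarrow> real"
  assumes "k \<in> K" "f \<in> borel_measurable M"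
  shows "(\<integral>y. f (y k) \<partial>PiM K (\<lambda>_. M)) = (\<integral>y. f y \<partial>M)"
proof -
  interpret P: product_prob_space "\<lambda>_. M" K ..
  have "(\<integral>y. f y \<partial>M) = (\<integral>y. f y \<partial>distr (PiM K (\<lambda>_. M)) M (\<lambda>y. y k))"
    using P.PiM_component[OF assms(1)] by simp
  also have "\<dots> = (\<integral>y. f (y k) \<partial>PiM K (\<lambda>_. M))"
    using assms by (intro integral_distr) auto
  finally show ?thesis ..
qed

lemma abs_sum_le_card:
  fixes f :: "'b \<Rightarrow> real"
  assumes "\<And>n. n \<in> V \<Longrightarrow> \<bar>f n\<bar> \<le> 1"
  shows "\<bar>\<Sum>n\<in>V. f n\<bar> \<le> card V"
proof -
  have "\<bar>\<Sum>n\<in>V. f n\<bar> \<le> (\<Sum>n\<in>V. \<bar>f n\<bar>)" by (rule sum_abs)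
  also have "\<dots> \<le> (\<Sum>n\<in>V. 1)" using assms by (intro sum_mono)
  finally show ?thesis by simp
qed

text \<open>Symmetrization: the index \<open>(n, True)\<close> carries an independent copy of the sample point
  with index \<open>(n, False)\<close>, and the signs arise from exchanging the two.\<close>

lemma (in prob_space) integral_Max_deviation_le:
  fixes V :: "'i set"
  assumes V: "finite V" and D: "finite \<D>" "\<D> \<noteq> {}" "\<D> \<subseteq> events"
    and R: "\<And>x. x \<in> V \<rightarrow> space M \<Longrightarrow>
      sign_mean V (\<lambda>\<epsilon>. Max ((\<lambda>C. \<bar>\<Sum>n\<in>V. indicator C (x n) * \<epsilon> n\<bar>) ` \<D>)) \<le> R"
  shows "(\<integral>x. Max ((\<lambda>C. \<bar>(\<Sum>n\<in>V. indicator C (x (n, False))) - card V * prob C\<bar>) ` \<D>)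
    \<partial>PiM (V \<times> {False}) (\<lambda>_. M)) \<le> 2 * R"
proof -
  define I where "I = (\<lambda>b::bool. V \<times> {b})"
  define J where "J = I False \<union> I True"
  \<comment> \<open>\<open>f\<close> treats both samples as one point of the product over
    \<open>J\<close> and carries the signs; \<open>h\<close> is the unsigned version with the
    samples as separate arguments, ready for Fubini.\<close>
  define f where "f = (\<lambda>(\<epsilon> :: 'i \<Rightarrow> real) \<omega>. Max ((\<lambda>C. \<bar>\<Sum>n\<in>V. (indicator C (\<omega> (n, False)) - indicator C (\<omega> (n, True))) * \<epsilon> n\<bar>) ` \<D>))"
  define h where "h = (\<lambda>x y. Max ((\<lambda>C. \<bar>\<Sum>n\<in>V. (indicator C (x (n, False)) - indicator C (y (n, True)) :: real)\<bar>) ` \<D>))"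
  interpret PS: product_sigma_finite "\<lambda>_ :: 'i \<times> bool. M" ..
  let ?P = "\<lambda>K. PiM K (\<lambda>_ :: 'i \<times> bool. M)"
  have prob: "prob_space (?P K)" for K
    by (intro prob_space_PiM prob_space_axioms)
  interpret Q: prob_space "?P J" by (rule prob)
  interpret Q0: prob_space "?P (I False)" by (rule prob)
  interpret Q1: prob_space "?P (I True)" by (rule prob)
  have events [measurable]: "C \<in> sets M" if "C \<in> \<D>" for C using that D by auto
  have comp [measurable]: "(\<lambda>\<omega>. \<omega> (n, b)) \<in> measurable (?P (I b)) M" if "n \<in> V" for n b
    using that by (intro measurable_component_singleton) (auto simp: I_def)
  have compJ [measurable]: "(\<lambda>\<omega>. \<omega> (n, b)) \<in> measurable (?P J) M" if "n \<in> V" for n b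
    using that by (intro measurable_component_singleton) (cases b; auto simp: I_def J_def)
  have Max_le: "\<bar>Max (F ` \<D>)\<bar> \<le> c" if "\<And>C. C \<in> \<D> \<Longrightarrow> 0 \<le> F C \<and> F C \<le> c" for F and c :: real
  proof -
    have "Max (F ` \<D>) \<in> F ` \<D>" using D by (intro Max_in) auto
    then show ?thesis using that by auto
  qed
  have f_meas [measurable]: "f \<epsilon> \<in> borel_measurable (?P J)" for \<epsilon>
    unfolding f_def using D by measurable
  have f_bound: "\<bar>f \<epsilon> \<omega>\<bar> \<le> card V" if "\<epsilon> \<in> signs V" for \<epsilon> \<omega>
    unfolding f_def
  proof (intro Max_le conjI abs_ge_zero abs_sum_le_card)
    fix C n assume "n \<in> V"
    then have "\<epsilon> n = 1 \<or> \<epsilon> n = -1" using that by (auto simp: signs_def PiE_iff)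
    then show "\<bar>(indicator C (\<omega> (n, False)) - indicator C (\<omega> (n, True))) * \<epsilon> n\<bar> \<le> 1"
      by (auto simp: indicator_def)
  qed
  have f_int: "integrable (?P J) (f \<epsilon>)" if "\<epsilon> \<in> signs V" for \<epsilon>
    using f_bound[OF that] by (intro Q.integrable_const_bound[of _ "card V"]) auto
  define e where "e = (\<lambda>n\<in>V. 1 :: real)"
  have e: "e \<in> signs V" by (auto simp: e_def signs_def)
  \<comment> \<open>\<open>g\<close> exchanges the two copies of \<open>n\<close> exactly where
    \<open>\<epsilon> n = -1\<close>. It permutes \<open>J\<close>, so the induced map
    \<open>T\<close> preserves the product measure, and composing \<open>f e\<close> with
    \<open>T\<close> gives \<open>f \<epsilon>\<close>.\<close>
  have swap: "(\<integral>\<omega>. f \<epsilon> \<omega> \<partial>?P J) = (\<integral>\<omega>. f e \<omega> \<partial>?P J)" if eps: "\<epsilon> \<in> signs V" for \<epsilon>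
  proof -
    define g where "g = (\<lambda>(n, b). (n, if \<epsilon> n = 1 then b else \<not> b))"
    define T where "T = (\<lambda>\<omega> :: 'i \<times> bool \<Rightarrow> 'a. \<lambda>k\<in>J. \<omega> (g k))"
    have gJ: "g \<in> J \<rightarrow> J"
      by (auto simp: g_def J_def I_def split: if_splits)
    have "inj_on g J"
      by (auto simp: inj_on_def g_def split: if_splits)
    then have distr: "distr (?P J) (?P J) T = ?P J"
      unfolding T_def using gJ by (intro distr_PiM_reindex prob_space_axioms)
    have T [measurable]: "T \<in> measurable (?P J) (?P J)"
      unfolding T_def using gJ by (intro measurable_restrict measurable_component_singleton) auto
    have "(\<integral>\<omega>. f e \<omega> \<partial>?P J) = (\<integral>\<omega>. f e \<omega> \<partial>distr (?P J) (?P J) T)"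
      by (simp add: distr)
    also have "\<dots> = (\<integral>\<omega>. f e (T \<omega>) \<partial>?P J)"
      by (intro integral_distr) measurable
    also have "(\<lambda>\<omega>. f e (T \<omega>)) = f \<epsilon>"
    proof
      fix \<omega>
      have "(indicator C (T \<omega> (n, False)) - indicator C (T \<omega> (n, True))) * e n
          = (indicator C (\<omega> (n, False)) - indicator C (\<omega> (n, True))) * \<epsilon> n" if "n \<in> V" for C n
      proof -
        have "\<epsilon> n = 1 \<or> \<epsilon> n = -1" using that eps by (auto simp: signs_def PiE_iff)
        then show ?thesis using that by (auto simp: T_def g_def e_def J_def I_def)
      qed
      then show "f e (T \<omega>) = f \<epsilon> \<omega>" unfolding f_def by (simp cong: sum.cong)
    qed
    finally show ?thesis ..
  qed
  \<comment> \<open>All sign choices give the same integral, so a mean over signs can be introduced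
    and moved inside. There the triangle inequality splits the two samples, each contributing
    \<open>R\<close>.\<close>
  have "(\<integral>\<omega>. f e \<omega> \<partial>?P J) = sign_mean V (\<lambda>_. \<integral>\<omega>. f e \<omega> \<partial>?P J)"
    using V by (simp add: sign_mean_const)
  also have "\<dots> = sign_mean V (\<lambda>\<epsilon>. \<integral>\<omega>. f \<epsilon> \<omega> \<partial>?P J)"
    by (simp add: sign_mean_def swap cong: sum.cong)
  also have "\<dots> = (\<integral>\<omega>. sign_mean V (\<lambda>\<epsilon>. f \<epsilon> \<omega>) \<partial>?P J)"
    by (simp add: sign_mean_def f_int cong: sum.cong)
  also have "\<dots> \<le> (\<integral>\<omega>. 2 * R \<partial>?P J)"
  proof (intro integral_mono)
    show "integrable (?P J) (\<lambda>\<omega>. sign_mean V (\<lambda>\<epsilon>. f \<epsilon> \<omega>))"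
      unfolding sign_mean_def using f_int by auto
    fix \<omega> assume \<omega>: "\<omega> \<in> space (?P J)"
    define m where "m = (\<lambda>b (\<epsilon> :: 'i \<Rightarrow> real). Max ((\<lambda>C. \<bar>\<Sum>n\<in>V. indicator C (\<omega> (n, b)) * \<epsilon> n\<bar>) ` \<D>))"
    have "sign_mean V (\<lambda>\<epsilon>. f \<epsilon> \<omega>) \<le> sign_mean V (\<lambda>\<epsilon>. m False \<epsilon> + m True \<epsilon>)"
    proof (intro sign_mean_mono)
      fix \<epsilon> :: "'i \<Rightarrow> real"
      show "f \<epsilon> \<omega> \<le> m False \<epsilon> + m True \<epsilon>"
        unfolding f_def
      proof (intro Max.boundedI)
        fix y assume "y \<in> (\<lambda>C. \<bar>\<Sum>n\<in>V. (indicator C (\<omega> (n, False)) - indicator C (\<omega> (n, True))) * \<epsilon> n\<bar>) ` \<D>"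
        then obtain C where C: "C \<in> \<D>"
          and y: "y = \<bar>\<Sum>n\<in>V. (indicator C (\<omega> (n, False)) - indicator C (\<omega> (n, True))) * \<epsilon> n\<bar>"
          by blast
        have "y \<le> \<bar>\<Sum>n\<in>V. indicator C (\<omega> (n, False)) * \<epsilon> n\<bar> + \<bar>\<Sum>n\<in>V. indicator C (\<omega> (n, True)) * \<epsilon> n\<bar>"
          unfolding y left_diff_distrib sum_subtractf by (rule abs_triangle_ineq4)
        also have "\<dots> \<le> m False \<epsilon> + m True \<epsilon>"
          unfolding m_def using C D by (intro add_mono Max_ge) auto
        finally show "y \<le> m False \<epsilon> + m True \<epsilon>" .
      qed (use D in auto)
    qed
    also have "\<dots> \<le> R + R"
    proof -
      have "(\<lambda>n. \<omega> (n, b)) \<in> V \<rightarrow> space M" for b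
        using \<omega> by (cases b) (auto simp: space_PiM PiE_iff J_def I_def)
      then show ?thesis
        unfolding sign_mean_add m_def by (intro add_mono R)
    qed
    finally show "sign_mean V (\<lambda>\<epsilon>. f \<epsilon> \<omega>) \<le> 2 * R" by simp
  qed simp
  also have "\<dots> = 2 * R" by (simp add: Q.prob_space)
  finally have upper: "(\<integral>\<omega>. f e \<omega> \<partial>?P J) \<le> 2 * R" .
  have h_meas [measurable]: "(\<lambda>(x, y). h x y) \<in> borel_measurable (?P (I False) \<Otimes>\<^sub>M ?P (I True))"
    unfolding h_def using D by measurable
  have h_bound: "\<bar>h x y\<bar> \<le> card V" for x y
    unfolding h_def
    by (intro Max_le conjI abs_ge_zero abs_sum_le_card) (auto simp: indicator_def)
  have h_int: "integrable (?P (I True)) (h x)" if x: "x \<in> space (?P (I False))" for x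
  proof (intro Q1.integrable_const_bound[of _ "card V"])
    show "h x \<in> borel_measurable (?P (I True))"
      using measurable_compose[OF measurable_Pair1'[OF x] h_meas] by simp
  qed (use h_bound in auto)
  have "(\<integral>\<omega>. f e \<omega> \<partial>?P J) = (\<integral>x. (\<integral>y. f e (merge (I False) (I True) (x, y)) \<partial>?P (I True)) \<partial>?P (I False))"
    unfolding J_def
    by (intro PS.product_integral_fold) (use V f_int[OF e] in \<open>auto simp: I_def J_def\<close>)
  also have "\<dots> = (\<integral>x. (\<integral>y. h x y \<partial>?P (I True)) \<partial>?P (I False))"
  proof -
    have "f e (merge (I False) (I True) (x, y)) = h x y" for x y
      unfolding f_def h_def by (simp add: e_def merge_def I_def cong: sum.cong)
    then show ?thesis by simp
  qed
  finally have fold: "(\<integral>\<omega>. f e \<omega> \<partial>?P J) = (\<integral>x. (\<integral>y. h x y \<partial>?P (I True)) \<partial>?P (I False))" .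
  \<comment> \<open>\<open>prob C\<close> is the mean of the indicator at an independent copy. For
    fixed \<open>x\<close> the deviation is therefore the absolute value of an average over
    \<open>y\<close>, at most the average of the absolute values, and hence at most that of
    \<open>h x y\<close>.\<close>
  have "(\<integral>x. Max ((\<lambda>C. \<bar>(\<Sum>n\<in>V. indicator C (x (n, False))) - card V * prob C\<bar>) ` \<D>) \<partial>?P (I False))
      \<le> (\<integral>x. (\<integral>y. h x y \<partial>?P (I True)) \<partial>?P (I False))"
  proof (intro integral_mono)
    have dev: "\<bar>(\<Sum>n\<in>V. indicator C (x (n, False))) - card V * prob C\<bar> \<le> card V" for C x
    proof -
      have "(\<Sum>n\<in>V. indicator C (x (n, False)) - prob C) = (\<Sum>n\<in>V. indicator C (x (n, False))) - card V * prob C"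
        by (simp add: sum_subtractf)
      moreover have "\<bar>\<Sum>n\<in>V. indicator C (x (n, False)) - prob C\<bar> \<le> card V"
        by (intro abs_sum_le_card) (auto simp: indicator_def)
      ultimately show ?thesis by simp
    qed
    show "integrable (?P (I False)) (\<lambda>x. Max ((\<lambda>C. \<bar>(\<Sum>n\<in>V. indicator C (x (n, False))) - card V * prob C\<bar>) ` \<D>))"
    proof (intro Q0.integrable_const_bound[of _ "card V"])
      show "(\<lambda>x. Max ((\<lambda>C. \<bar>(\<Sum>n\<in>V. indicator C (x (n, False))) - card V * prob C\<bar>) ` \<D>))
          \<in> borel_measurable (?P (I False))"
        using D by measurable
    qed (use Max_le dev in auto)
    show "integrable (?P (I False)) (\<lambda>x. \<integral>y. h x y \<partial>?P (I True))"
    proof (intro Q0.integrable_const_bound[of _ "card V"])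
      show "(\<lambda>x. \<integral>y. h x y \<partial>?P (I True)) \<in> borel_measurable (?P (I False))"
        by measurable
      have "\<bar>\<integral>y. h x y \<partial>?P (I True)\<bar> \<le> card V" if "x \<in> space (?P (I False))" for x
      proof -
        have "\<bar>\<integral>y. h x y \<partial>?P (I True)\<bar> \<le> (\<integral>y. \<bar>h x y\<bar> \<partial>?P (I True))"
          by (rule integral_abs_bound)
        also have "\<dots> \<le> (\<integral>y. card V \<partial>?P (I True))"
          using h_int[OF that] h_bound by (intro integral_mono) auto
        finally show ?thesis by (simp add: Q1.prob_space)
      qed
      then show "AE x in ?P (I False). norm (\<integral>y. h x y \<partial>?P (I True)) \<le> card V" by simp
    qed
    fix x assume x: "x \<in> space (?P (I False))"
    show "Max ((\<lambda>C. \<bar>(\<Sum>n\<in>V. indicator C (x (n, False))) - card V * prob C\<bar>) ` \<D>) \<le> (\<integral>y. h x y \<partial>?P (I True))"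
    proof (intro Max.boundedI)
      fix z assume "z \<in> (\<lambda>C. \<bar>(\<Sum>n\<in>V. indicator C (x (n, False))) - card V * prob C\<bar>) ` \<D>"
      then obtain C where C [measurable]: "C \<in> \<D>"
        and z: "z = \<bar>(\<Sum>n\<in>V. indicator C (x (n, False))) - card V * prob C\<bar>" by blast
      define u where "u = (\<lambda>y :: 'i \<times> bool \<Rightarrow> 'a. \<Sum>n\<in>V. (indicator C (x (n, False)) - indicator C (y (n, True)) :: real))"
      have [measurable]: "C \<in> sets M" using C D by auto
      have int1: "integrable (?P (I True)) (\<lambda>y. indicator C (y (n, True)) :: real)" if "n \<in> V" for n
      proof (intro Q1.integrable_const_bound[of _ 1])
        show "(\<lambda>y. indicator C (y (n, True)) :: real) \<in> borel_measurable (?P (I True))"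
          using that by measurable
      qed (auto simp: indicator_def)
      have "(\<integral>y. u y \<partial>?P (I True)) = (\<Sum>n\<in>V. indicator C (x (n, False)) - prob C)"
      proof -
        have "(\<integral>y. indicator C (y (n, True)) \<partial>?P (I True)) = prob C" if "n \<in> V" for n
          using integral_PiM_component[of "(n, True)" "I True" "indicator C"] that by (simp add: I_def)
        then show ?thesis
          unfolding u_def using int1 by (simp add: Q1.prob_space cong: sum.cong)
      qed
      then have "z = \<bar>\<integral>y. u y \<partial>?P (I True)\<bar>"
        by (simp add: z sum_subtractf)
      also have "\<dots> \<le> (\<integral>y. \<bar>u y\<bar> \<partial>?P (I True))"
        by (rule integral_abs_bound)
      also have "\<dots> \<le> (\<integral>y. h x y \<partial>?P (I True))"
      proof (intro integral_mono h_int x)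
        show "integrable (?P (I True)) (\<lambda>y. \<bar>u y\<bar>)"
          unfolding u_def using int1 by auto
        show "\<bar>u y\<bar> \<le> h x y" for y
          unfolding u_def h_def using C D by (intro Max_ge) auto
      qed
      finally show "z \<le> (\<integral>y. h x y \<partial>?P (I True))" .
    qed (use D in auto)
  qed
  with upper fold show ?thesis by (simp add: I_def)
qed

subsection \<open>The discrepancy bound\<close>

text \<open>If every sample had some deviation above \<open>2 * B\<close>, the supremum of the
  increasing maxima would be at least \<open>2 * B\<close> everywhere, whereas by monotone
  convergence its integral is at most \<open>B\<close>. A bound uniform in \<open>j\<close> thus
  passes to the union of the subclasses.\<close>

lemma (in prob_space) exists_sample_Max_deviation_le:
  fixes \<D> :: "nat \<Rightarrow> 'a set set" and B :: real
  assumes V: "finite V" and "B > 0"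
    and D: "\<And>j. finite (\<D> j)" "\<And>j. \<D> j \<noteq> {}" "\<And>j. \<D> j \<subseteq> events" "mono \<D>"
    and B: "\<And>j. (\<integral>x. Max ((\<lambda>C. \<bar>(\<Sum>n\<in>V. indicator C (x n)) - card V * prob C\<bar>) ` \<D> j)
      \<partial>PiM V (\<lambda>_. M)) \<le> B"
  shows "\<exists>x\<in>V \<rightarrow> space M. \<forall>j. \<forall>C\<in>\<D> j.
    \<bar>(\<Sum>n\<in>V. indicator C (x n)) - card V * prob C\<bar> \<le> 2 * B"
proof -
  let ?P = "PiM V (\<lambda>_. M)"
  interpret Q: prob_space ?P by (intro prob_space_PiM prob_space_axioms)
  define g where "g = (\<lambda>j x. Max ((\<lambda>C. \<bar>(\<Sum>n\<in>V. indicator C (x n)) - card V * prob C\<bar>) ` \<D> j))"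
  have events [measurable]: "C \<in> sets M" if "C \<in> \<D> j" for C j using that D by auto
  have [measurable]: "(\<lambda>\<omega>. \<omega> n) \<in> measurable ?P M" if "n \<in> V" for n
    using that by (intro measurable_component_singleton)
  have g_meas [measurable]: "g j \<in> borel_measurable ?P" for j
    unfolding g_def using D(1)[of j] by measurable
  have g_ge: "\<bar>(\<Sum>n\<in>V. indicator C (x n)) - card V * prob C\<bar> \<le> g j x" if "C \<in> \<D> j" for C j x
    unfolding g_def using that D(1) by (intro Max_ge) auto
  have g_nonneg: "0 \<le> g j x" for j x
    using D(2)[of j] g_ge[of _ j x] abs_ge_zero order_trans by (metis ex_in_conv)
  have g_le: "g j x \<le> card V" for j x
    unfolding g_def
  proof (intro Max.boundedI)
    fix z assume "z \<in> (\<lambda>C. \<bar>(\<Sum>n\<in>V. indicator C (x n)) - card V * prob C\<bar>) ` \<D> j"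
    then obtain C where z: "z = \<bar>(\<Sum>n\<in>V. indicator C (x n)) - card V * prob C\<bar>" by blast
    have "z = \<bar>\<Sum>n\<in>V. indicator C (x n) - prob C\<bar>"
      by (simp add: z sum_subtractf)
    also have "\<dots> \<le> card V"
      by (intro abs_sum_le_card) (auto simp: indicator_def)
    finally show "z \<le> card V" .
  qed (use D in auto)
  have g_int: "integrable ?P (g j)" for j
    using g_le g_nonneg by (intro Q.integrable_const_bound[of _ "card V"]) auto
  have g_mono: "incseq (\<lambda>j x. ennreal (g j x))"
  proof (intro monoI le_funI ennreal_leI)
    fix i j x assume "i \<le> (j :: nat)"
    then show "g i x \<le> g j x"
      unfolding g_def using D monoD[OF D(4)] by (intro Max_mono image_mono) auto
  qed
  have "\<exists>x\<in>space ?P. \<forall>j. g j x \<le> 2 * B"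
  proof (rule ccontr)
    assume "\<not> ?thesis"
    then have ex: "\<exists>j. 2 * B < g j x" if "x \<in> space ?P" for x
      using that by (auto simp: not_le)
    have "ennreal (2 * B) = (\<integral>\<^sup>+x. ennreal (2 * B) \<partial>?P)"
      by (simp add: Q.emeasure_space_1)
    also have "\<dots> \<le> (\<integral>\<^sup>+x. (SUP j. ennreal (g j x)) \<partial>?P)"
    proof (intro nn_integral_mono)
      fix x assume "x \<in> space ?P"
      then obtain j where "2 * B < g j x" using ex by blast
      then show "ennreal (2 * B) \<le> (SUP j. ennreal (g j x))"
        by (intro SUP_upper2[of j] ennreal_leI) auto
    qed
    also have "\<dots> = (SUP j. \<integral>\<^sup>+x. ennreal (g j x) \<partial>?P)"
      using g_mono by (intro nn_integral_monotone_convergence_SUP) auto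
    also have "\<dots> \<le> ennreal B"
    proof (intro SUP_least)
      fix j
      have "(\<integral>\<^sup>+x. ennreal (g j x) \<partial>?P) = ennreal (\<integral>x. g j x \<partial>?P)"
        using g_int g_nonneg by (intro nn_integral_eq_integral) auto
      also have "\<dots> \<le> ennreal B"
        using B by (intro ennreal_leI) (simp add: g_def)
      finally show "(\<integral>\<^sup>+x. ennreal (g j x) \<partial>?P) \<le> ennreal B" .
    qed
    finally show False using \<open>B > 0\<close> by (simp add: ennreal_le_iff)
  qed
  then obtain x where x: "x \<in> space ?P" "\<And>j. g j x \<le> 2 * B" by blast
  show ?thesis
  proof (intro bexI allI ballI)
    show "x \<in> V \<rightarrow> space M" using x(1) by (auto simp: space_PiM PiE_iff)
    show "\<bar>(\<Sum>n\<in>V. indicator C (x n)) - card V * prob C\<bar> \<le> 2 * B" if "C \<in> \<D> j" for j C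
      using g_ge[OF that] x(2) by (rule order_trans)
  qed
qed

text \<open>The constant is \<open>92 = 23 * 2 * 2\<close>: \<open>23\<close> from chaining, and a
  factor \<open>2\<close> each from symmetrization and from the selection of one sample.\<close>

lemma VC_class_discrepancy_le:
  fixes P :: "'a measure"
  assumes "prob_space P" and "countable \<C>" and "\<C> \<subseteq> sets P"
    and VC: "VC_class_of_index (space P) \<C> d" and "d \<ge> 1" and "N \<ge> 1"
  obtains t where "\<And>n. n \<in> {1..N} \<Longrightarrow> t n \<in> space P"
    "discrepancy P \<C> N t \<le> 92 * (sqrt (real d) / sqrt (real N))"
proof -
  interpret prob_space P by fact
  \<comment> \<open>Shattering even the empty set takes a member of the class. Nonemptiness is what
    \<open>cSUP_least\<close> and the enumeration of \<open>\<C>\<close> require.\<close>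
  have ne: "\<C> \<noteq> {}"
    using VC unfolding VC_class_of_index_def shatters_def by blast
  \<comment> \<open>An increasing exhaustion by finite subclasses; for finite \<open>\<C>\<close>
    the enumeration merely repeats members.\<close>
  define \<D> where "\<D> = (\<lambda>j. from_nat_into \<C> ` {..j})"
  have UD: "\<exists>j. C \<in> \<D> j" if "C \<in> \<C>" for C
    using from_nat_into_surj[OF assms(2) that] by (auto simp: \<D>_def)
  have D: "finite (\<D> j)" "\<D> j \<noteq> {}" "\<D> j \<subseteq> \<C>" for j
    using from_nat_into[OF ne] by (auto simp: \<D>_def)
  have "mono \<D>" by (auto simp: \<D>_def mono_def)
  define B where "B = 2 * (23 * (sqrt d * sqrt N))"
  have "B > 0" using \<open>d \<ge> 1\<close> \<open>N \<ge> 1\<close> by (simp add: B_def)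
  have V: "finite {1..N}" "{1..N} \<noteq> {}" using \<open>N \<ge> 1\<close> by auto
  have card: "card ({1..N} \<times> {False}) = N" by simp
  have "sign_mean {1..N} (\<lambda>\<epsilon>. Max ((\<lambda>C. \<bar>\<Sum>n\<in>{1..N}. indicator C (x n) * \<epsilon> n\<bar>) ` \<D> j))
      \<le> 23 * (sqrt d * sqrt N)" if "x \<in> {1..N} \<rightarrow> space P" for x j
  proof -
    have "card A \<le> d" if "A \<subseteq> space P" "finite A" "shatters (\<D> j) A" for A
      using VC that shatters_mono[OF D(3) that(3)] unfolding VC_class_of_index_def by blast
    then show ?thesis
      using sign_mean_Max_VC_class_le[OF V D(1,2) that _ \<open>d \<ge> 1\<close>] by simp
  qed
  then have "(\<integral>x. Max ((\<lambda>C. \<bar>(\<Sum>n\<in>{1..N}. indicator C (x (n, False))) - card {1..N} * prob C\<bar>) ` \<D> j)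
      \<partial>PiM ({1..N} \<times> {False}) (\<lambda>_. P)) \<le> B" for j
    unfolding B_def using D subset_trans[OF D(3) assms(3)]
    by (intro integral_Max_deviation_le V) auto
  \<comment> \<open>Symmetrization places the sample on \<open>{1..N} \<times> {False}\<close>;
    reindexing lets the selection of a sample use that same index set.\<close>
  moreover have sum: "(\<Sum>k\<in>{1..N} \<times> {False}. indicator C (x k)) = (\<Sum>n\<in>{1..N}. indicator C (x (n, False)) :: real)"
    for C and x :: "nat \<times> bool \<Rightarrow> 'a"
    by (rule sum.reindex_cong[of "\<lambda>n. (n, False)"]) (auto simp: inj_on_def)
  ultimately have int: "(\<integral>x. Max ((\<lambda>C. \<bar>(\<Sum>n\<in>{1..N} \<times> {False}. indicator C (x n))
      - card ({1..N} \<times> {False}) * prob C\<bar>) ` \<D> j) \<partial>PiM ({1..N} \<times> {False}) (\<lambda>_. P)) \<le> B" for j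
    unfolding card sum by simp
  have fin: "finite ({1..N} \<times> {False})" by simp
  obtain x where x: "x \<in> {1..N} \<times> {False} \<rightarrow> space P"
    and dev: "\<And>j C. C \<in> \<D> j \<Longrightarrow>
      \<bar>(\<Sum>n\<in>{1..N} \<times> {False}. indicator C (x n)) - card ({1..N} \<times> {False}) * prob C\<bar> \<le> 2 * B"
    using exists_sample_Max_deviation_le[OF fin \<open>B > 0\<close> D(1,2)
          subset_trans[OF D(3) assms(3)] \<open>mono \<D>\<close> int] by blast
  show thesis
  proof (rule that)
    show "x (n, False) \<in> space P" if "n \<in> {1..N}" for n
      using x that by auto
    show "discrepancy P \<C> N (\<lambda>n. x (n, False)) \<le> 92 * (sqrt (real d) / sqrt (real N))"
      unfolding discrepancy_def
    proof (rule cSUP_least[OF ne])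
      fix C assume "C \<in> \<C>"
      then obtain j where "C \<in> \<D> j" using UD by blast
      then have le: "\<bar>(\<Sum>n\<in>{1..N}. indicator C (x (n, False))) - N * prob C\<bar> \<le> 2 * B"
        using dev unfolding card sum by blast
      have "\<bar>1 / real N * (\<Sum>n = 1..N. indicator C (x (n, False))) - prob C\<bar>
          = \<bar>1 / real N * ((\<Sum>n = 1..N. indicator C (x (n, False))) - N * prob C)\<bar>"
        using \<open>N \<ge> 1\<close> by (simp add: field_simps)
      also have "\<dots> = \<bar>(\<Sum>n = 1..N. indicator C (x (n, False))) - N * prob C\<bar> / N"
        by (simp add: abs_mult)
      also have "\<dots> \<le> 2 * B / N"
        using le by (intro divide_right_mono) auto
      also have "\<dots> = 92 * (sqrt d * (sqrt N / N))"
        by (simp add: B_def)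
      also have "sqrt N / N = 1 / sqrt N"
        using \<open>N \<ge> 1\<close> by (simp add: sqrt_divide_self_eq inverse_eq_divide)
      finally show "\<bar>1 / real N * (\<Sum>n = 1..N. indicator C (x (n, False))) - prob C\<bar>
          \<le> 92 * (sqrt d / sqrt N)"
        by simp
    qed
  qed
qed

theorem theorem3:
  fixes P :: "'a measure" and \<C> :: "'a set set" and d :: nat
  assumes "prob_space P"
    and "countable \<C>"
    and "\<C> \<subseteq> sets P"
    and "VC_class_of_index (space P) \<C> d"
    and "d \<ge> 1"
  shows "(\<forall>N::nat. N \<ge> 1 \<longrightarrow>
            (\<exists>t. (\<forall>n\<in>{1..N}. t n \<in> space P) \<and>
                 discrepancy P \<C> N t \<le> 2 ^ 13 * (sqrt (real d) / sqrt (real N)))) \<and>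
         (\<forall>\<epsilon>::real. 0 < \<epsilon> \<and> \<epsilon> < 1 \<longrightarrow>
            (\<exists>(N::nat) t. N \<ge> 1 \<and> real N \<le> 2 ^ 26 * real d * (1 / \<epsilon>\<^sup>2) \<and>
                 (\<forall>n\<in>{1..N}. t n \<in> space P) \<and>
                 discrepancy P \<C> N t \<le> \<epsilon>))"
proof (intro conjI allI impI)
  fix N :: nat assume "N \<ge> 1"
  then obtain t where t: "\<And>n. n \<in> {1..N} \<Longrightarrow> t n \<in> space P"
    "discrepancy P \<C> N t \<le> 92 * (sqrt (real d) / sqrt (real N))"
    using VC_class_discrepancy_le[OF assms] by blast
  have "92 * (sqrt (real d) / sqrt (real N)) \<le> 2 ^ 13 * (sqrt (real d) / sqrt (real N))"
    by (intro mult_right_mono) auto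
  with t show "\<exists>t. (\<forall>n\<in>{1..N}. t n \<in> space P) \<and>
      discrepancy P \<C> N t \<le> 2 ^ 13 * (sqrt (real d) / sqrt (real N))"
    by (intro exI[of _ t]) auto
next
  fix \<epsilon> :: real assume "0 < \<epsilon> \<and> \<epsilon> < 1"
  then have \<epsilon>: "0 < \<epsilon>" "\<epsilon> < 1" by auto
  define L where "L = 2 ^ 26 * real d * (1 / \<epsilon>\<^sup>2)"
  \<comment> \<open>The largest admissible number of points. As \<open>L \<ge> 1\<close>, rounding
    down loses at most a factor \<open>2\<close>.\<close>
  define N where "N = nat \<lfloor>L\<rfloor>"
  have "\<epsilon>\<^sup>2 \<le> 1" using \<epsilon> by (simp add: power_le_one)
  then have "1 \<le> real d * (1 / \<epsilon>\<^sup>2)"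
    using \<epsilon> \<open>d \<ge> 1\<close> by (simp add: field_simps)
  then have "1 \<le> L" by (simp add: L_def)
  then have "1 \<le> \<lfloor>L\<rfloor>" and "real N = \<lfloor>L\<rfloor>"
    by (simp_all add: N_def le_floor_iff)
  then have N: "N \<ge> 1" "real N \<le> L" "L \<le> 2 * real N"
    using floor_correct[of L] by linarith+
  obtain t where t: "\<And>n. n \<in> {1..N} \<Longrightarrow> t n \<in> space P"
    "discrepancy P \<C> N t \<le> 92 * (sqrt (real d) / sqrt (real N))"
    using VC_class_discrepancy_le[OF assms N(1)] by blast
  note t(2)
  also have "92 * (sqrt (real d) / sqrt (real N)) \<le> \<epsilon>"
  proof (rule power2_le_imp_le)
    \<comment> \<open>After squaring, the goal is
      \<open>92\<^sup>2 * d \<le> \<epsilon>\<^sup>2 * N\<close>; since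
      \<open>\<epsilon>\<^sup>2 * (L / 2) = 2 ^ 25 * d\<close>, there is ample room.\<close>
    have "92\<^sup>2 * real d \<le> \<epsilon>\<^sup>2 * (L / 2)"
      using \<epsilon> by (simp add: L_def)
    also have "\<dots> \<le> \<epsilon>\<^sup>2 * real N"
      using N(3) by (intro mult_left_mono) auto
    finally show "(92 * (sqrt (real d) / sqrt (real N)))\<^sup>2 \<le> \<epsilon>\<^sup>2"
      using N(1) by (simp add: power_mult_distrib power_divide field_simps)
  qed (use \<epsilon> in auto)
  finally show "\<exists>(N::nat) t. N \<ge> 1 \<and> real N \<le> 2 ^ 26 * real d * (1 / \<epsilon>\<^sup>2) \<and>
      (\<forall>n\<in>{1..N}. t n \<in> space P) \<and> discrepancy P \<C> N t \<le> \<epsilon>"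
    using t(1) N(1,2) by (intro exI[of _ N] exI[of _ t]) (auto simp: L_def)
qed

end
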